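(* Suppose $n\geq2$ and $k\geq 3$. Let $E$ be the set of all $k$-ary $n$-tuples with pseudoweight less than $nk/2$. Then $D^{-1}(E)$ is the set of edges of a connected subgraph of $B_{k}(n)$; that is, the subgraph of $B_k(n)$ with edge set $D^{-1}(E)$ is connected after removal of any vertices with in-degree and out-degree zero.
   Context: The de Bruijn digraph $B_k(n)$ has vertex set $\mathbb{Z}_k^n$, and $(\mathbf{x},\mathbf{y})$ is a (directed) edge iff $y_i=x_{i+1}$ for $0\le i<n-1$; this edge is identified with the $(n+1)$-tuple $(x_0,\ldots,x_{n-1},y_{n-1})$. Pseudoweight: define $f:\mathbb{Z}_k\to\mathbb{Q}$ by regarding $u\in\mathbb{Z}_k$ as an integer in $[0,k-1]$ and setting $f(u)=u$ if $u\ne 0$ and $f(0)=k/2$. The pseudoweight of $\mathbf{u}=(u_0,\ldots,u_{n-1})\in\mathbb{Z}_k^n$ is $w^*(\mathbf{u})=\sum_{i=0}^{n-1} f(u_i)$, computed in $\mathbb{Q}$. Lempel homomorphism: $D(a_0,a_1,\ldots,a_n)=(a_1-a_0,a_2-a_1,\ldots,a_n-a_{n-1})$, with differences in $\mathbb{Z}_k$. $D^{-1}(E)$ is the set of $k$-ary $(n+1)$-tuples $\mathbf{a}$ with $D(\mathbf{a})\in E$. *)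

theory Defs
  imports Complex_Main "Graph_Theory.Graph_Theory"
begin

text \<open>
  \<open>\<int>\<^sub>k\<close> is represented by the integers \<open>0, \<dots>, k - 1\<close> with arithmetic modulo \<open>k\<close>, and
  an \<open>n\<close>-tuple over \<open>\<int>\<^sub>k\<close> by a list of length \<open>n\<close>.
\<close>

definition tuples :: "nat \<Rightarrow> nat \<Rightarrow> int list set" where
  "tuples k n = {u. length u = n \<and> set u \<subseteq> {0..<int k}}"

definition de_bruijn :: "nat \<Rightarrow> nat \<Rightarrow> (int list, int list \<times> int list) pre_digraph" where
  "de_bruijn k n =
     \<lparr> verts = tuples k n,
       arcs = {(x, y). x \<in> tuples k n \<and> y \<in> tuples k n \<and> (\<forall>i<n - 1. y ! i = x ! (i + 1))},
       tail = fst, head = snd \<rparr>"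

text \<open>
  The \<open>(n + 1)\<close>-tuple \<open>(x\<^sub>0, \<dots>, x\<^bsub>n-1\<^esub>, y\<^bsub>n-1\<^esub>)\<close> with which the edge \<open>(x, y)\<close> is identified.
\<close>

definition edge_tuple :: "int list \<times> int list \<Rightarrow> int list" where
  "edge_tuple e = fst e @ [last (snd e)]"

lemma bij_betw_edge_tuple:
  assumes "n \<ge> 1"
  shows "bij_betw edge_tuple (arcs (de_bruijn k n)) (tuples k (n + 1))"
proof (rule bij_betwI[where g = "\<lambda>a. (butlast a, tl a)"])
  show "edge_tuple \<in> arcs (de_bruijn k n) \<rightarrow> tuples k (n + 1)"
    using assms by (auto simp: de_bruijn_def edge_tuple_def tuples_def subset_iff)
      (metis Suc_le_eq last_in_set length_greater_0_conv atLeastLessThan_iff)+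
next
  show "(\<lambda>a. (butlast a, tl a)) \<in> tuples k (n + 1) \<rightarrow> arcs (de_bruijn k n)"
    by (auto simp: de_bruijn_def tuples_def subset_iff nth_butlast nth_tl
        dest: in_set_butlastD list.set_sel(2)[rotated])
next
  fix e assume e: "e \<in> arcs (de_bruijn k n)"
  obtain x y where xy: "e = (x, y)" by fastforce
  have "tl (x @ [last y]) = y"
  proof (rule nth_equalityI)
    show "length (tl (x @ [last y])) = length y"
      using e xy by (auto simp: de_bruijn_def tuples_def)
    fix i assume "i < length (tl (x @ [last y]))"
    then have "i < n" and len: "length x = n" "length y = n"
      using e xy by (auto simp: de_bruijn_def tuples_def)
    moreover from this have "y \<noteq> []" by auto
    ultimately show "tl (x @ [last y]) ! i = y ! i"
      using e xy by (cases "i = n - 1")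
        (auto simp: de_bruijn_def nth_tl nth_append last_conv_nth)
  qed
  then show "(butlast (edge_tuple e), tl (edge_tuple e)) = e"
    using xy by (simp add: edge_tuple_def)
next
  fix a assume "a \<in> tuples k (n + 1)"
  then have "length a = n + 1" by (simp add: tuples_def)
  then have "a \<noteq> []" "tl a \<noteq> []" using assms by (auto simp: tl_Nil)
  then show "edge_tuple (butlast a, tl a) = a"
    by (simp add: edge_tuple_def last_tl)
qed

definition remove_isolated :: "('a, 'b) pre_digraph \<Rightarrow> ('a, 'b) pre_digraph" where
  "remove_isolated G = G \<restriction> {v \<in> verts G. \<not> (in_degree G v = 0 \<and> out_degree G v = 0)}"

definition de_bruijn_subgraph ::
  "nat \<Rightarrow> nat \<Rightarrow> int list set \<Rightarrow> (int list, int list \<times> int list) pre_digraph" where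
  "de_bruijn_subgraph k n X =
     remove_isolated
       ((de_bruijn k n) \<lparr> arcs := {e \<in> arcs (de_bruijn k n). edge_tuple e \<in> X} \<rparr>)"

definition pseudoweight :: "nat \<Rightarrow> int list \<Rightarrow> rat" where
  "pseudoweight k u =
     (\<Sum>i<length u. if u ! i = 0 then of_nat k / 2 else of_int (u ! i))"

definition lempel :: "nat \<Rightarrow> int list \<Rightarrow> int list" where
  "lempel k a = map (\<lambda>i. (a ! (i + 1) - a ! i) mod int k) [0..<length a - 1]"

definition lempel_preimage :: "nat \<Rightarrow> nat \<Rightarrow> int list set \<Rightarrow> int list set" where
  "lempel_preimage k n E = {a \<in> tuples k (n + 1). lempel k a \<in> E}"

end

theory Submission
  imports Defs
begin

text \<open>
  Every letter of \<open>\<int>\<^sub>k\<close> contributes at least 1 to a pseudoweight, and the letter 1 contributes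
  exactly 1. Call a vertex of the de Bruijn digraph light if the pseudoweight of its word of
  differences is less than \<open>nk/2 - 1\<close>. An edge is a vertex extended by one letter, hence its
  difference word is that of either endpoint extended by one difference. So both endpoints of
  an edge in \<open>D\<^sup>-\<^sup>1(E)\<close> are light, and conversely a light vertex may be extended, on the right
  or on the left, by a letter at difference 1 and yields an edge in \<open>D\<^sup>-\<^sup>1(E)\<close>. The light
  vertices are therefore exactly the vertices that survive, and from each of them one can walk
  forwards along differences 1 (\<open>climb\<close>), or trace a walk backwards along differences 1
  (\<open>descend\<close>), for as long as one likes, since each new endpoint is light again.

  After \<open>n\<close> such steps nothing is left of the original tuple: forwards as well as backwards the
  walk arrives at a ramp \<open>(c, c+1, \<dots>, c+n-1)\<close> (lemmas \<open>climb_iterate\<close> and \<open>descend_iterate\<close>).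
  The ramps form one directed cycle, because climbing from the ramp at \<open>c\<close> leads to the ramp at
  \<open>c + 1\<close>. Thus any vertex \<open>x\<close> reaches any vertex \<open>y\<close> by climbing from \<open>x\<close> to a ramp, running
  along the cycle, and following the traced walk forwards from a ramp to \<open>y\<close>. This even gives strong
  connectedness. The bound \<open>k \<ge> 3\<close> enters through the ramps themselves: a run of \<open>n\<close>
  differences 1 has pseudoweight \<open>n\<close>, which has to be less than \<open>nk/2\<close>.
\<close>

section \<open>Removing isolated vertices\<close>

text \<open>
  Finiteness matters because degrees are cardinalities: infinitely many incoming or outgoing
  arcs would count as degree 0.
\<close>

lemma remove_isolated_arcs:
  assumes "wf_digraph G" "finite (arcs G)"
  shows "verts (remove_isolated G) = tail G ` arcs G \<union> head G ` arcs G"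
    and "arcs (remove_isolated G) = arcs G"
    and "subgraph (remove_isolated G) G"
proof -
  interpret wf_digraph G by fact
  have *: "{v \<in> verts G. \<not> (in_degree G v = 0 \<and> out_degree G v = 0)}
      = tail G ` arcs G \<union> head G ` arcs G"
    using assms(2) by (auto simp: in_degree_def out_degree_def in_arcs_def out_arcs_def)
  show "verts (remove_isolated G) = tail G ` arcs G \<union> head G ` arcs G"
    unfolding remove_isolated_def * by simp
  show "arcs (remove_isolated G) = arcs G"
    unfolding remove_isolated_def * by (auto simp: induce_subgraph_def)
  show "subgraph (remove_isolated G) G"
    unfolding remove_isolated_def
    by (intro induced_imp_subgraph induced_induce) auto
qed

section \<open>Edges of the de Bruijn digraph as tuples\<close>

lemma finite_tuples: "finite (tuples k n)"
proof -
  have "tuples k n = {u. set u \<subseteq> {0..<int k} \<and> length u = n}"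
    by (auto simp: tuples_def)
  then show ?thesis
    by (simp add: finite_lists_length_eq)
qed

lemma edge_tuple_butlast_tl:
  assumes "length a \<ge> 2"
  shows "edge_tuple (butlast a, tl a) = a"
proof -
  have "a \<noteq> []" "tl a \<noteq> []"
    using assms by (auto simp: tl_Nil)
  then show ?thesis
    by (simp add: edge_tuple_def last_tl)
qed

text \<open>
  The inverse of \<^const>\<open>edge_tuple\<close>: an \<open>(n + 1)\<close>-tuple is the edge from its first \<open>n\<close> letters
  to its last \<open>n\<close> letters. This turns a set of edges given by tuples into an explicit image.
\<close>

lemma butlast_tl_arc:
  assumes "a \<in> tuples k (n + 1)"
  shows "(butlast a, tl a) \<in> arcs (de_bruijn k n)"
  using assms
  by (auto simp: de_bruijn_def tuples_def subset_iff nth_butlast nth_tl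
      dest: in_set_butlastD list.set_sel(2)[rotated])

lemma arcs_edge_tuple_in:
  assumes "n \<ge> 1" and "X \<subseteq> tuples k (n + 1)"
  shows "{e \<in> arcs (de_bruijn k n). edge_tuple e \<in> X} = (\<lambda>a. (butlast a, tl a)) ` X"
proof (intro equalityI subsetI)
  fix e
  assume e: "e \<in> {e \<in> arcs (de_bruijn k n). edge_tuple e \<in> X}"
  define a where "a = edge_tuple e"
  have a: "a \<in> tuples k (n + 1)"
    using e assms(2) by (auto simp: a_def)
  then have "edge_tuple (butlast a, tl a) = edge_tuple e"
    using assms(1) by (subst edge_tuple_butlast_tl) (auto simp: a_def tuples_def)
  then have "(butlast a, tl a) = e"
    using bij_betw_imp_inj_on[OF bij_betw_edge_tuple[OF assms(1)]] butlast_tl_arc[OF a] e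
    by (auto dest: inj_onD)
  then show "e \<in> (\<lambda>a. (butlast a, tl a)) ` X"
    using e by (metis (mono_tags, lifting) a_def image_eqI mem_Collect_eq)
next
  fix e
  assume "e \<in> (\<lambda>a. (butlast a, tl a)) ` X"
  then obtain a where "a \<in> X" "e = (butlast a, tl a)"
    by blast
  then show "e \<in> {e \<in> arcs (de_bruijn k n). edge_tuple e \<in> X}"
    using assms butlast_tl_arc edge_tuple_butlast_tl[of a] by (auto simp: tuples_def)
qed

lemma wf_digraph_de_bruijn: "wf_digraph (de_bruijn k n)"
  by unfold_locales (auto simp: de_bruijn_def)

lemma finite_arcs_de_bruijn: "finite (arcs (de_bruijn k n))"
  by (rule finite_subset[of _ "tuples k n \<times> tuples k n"])
    (auto simp: de_bruijn_def finite_tuples)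

lemma de_bruijn_subgraph_simps:
  assumes "n \<ge> 1" and "X \<subseteq> tuples k (n + 1)"
  shows "verts (de_bruijn_subgraph k n X) = butlast ` X \<union> tl ` X"
    and "arcs (de_bruijn_subgraph k n X) = (\<lambda>a. (butlast a, tl a)) ` X"
    and "tail (de_bruijn_subgraph k n X) = fst"
    and "head (de_bruijn_subgraph k n X) = snd"
    and "subgraph (de_bruijn_subgraph k n X) (de_bruijn k n)"
proof -
  let ?G = "de_bruijn k n"
  let ?K = "?G \<lparr> arcs := {e \<in> arcs ?G. edge_tuple e \<in> X} \<rparr>"
  have wf: "wf_digraph ?K"
    by unfold_locales (auto simp: de_bruijn_def)
  have fin: "finite (arcs ?K)"
    using finite_arcs_de_bruijn by simp
  have sub: "subgraph ?K ?G"
    using wf wf_digraph_de_bruijn by (auto simp: subgraph_def compatible_def)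
  have arcs: "arcs ?K = (\<lambda>a. (butlast a, tl a)) ` X"
    using arcs_edge_tuple_in[OF assms] by simp
  have ht: "tail ?K = fst" "head ?K = snd"
    by (simp_all add: de_bruijn_def)
  show "verts (de_bruijn_subgraph k n X) = butlast ` X \<union> tl ` X"
    unfolding de_bruijn_subgraph_def remove_isolated_arcs(1)[OF wf fin] arcs ht
    by (simp add: image_image)
  show "arcs (de_bruijn_subgraph k n X) = (\<lambda>a. (butlast a, tl a)) ` X"
    unfolding de_bruijn_subgraph_def remove_isolated_arcs(2)[OF wf fin] arcs ..
  show "tail (de_bruijn_subgraph k n X) = fst" "head (de_bruijn_subgraph k n X) = snd"
    by (simp_all add: de_bruijn_subgraph_def remove_isolated_def de_bruijn_def)
  show "subgraph (de_bruijn_subgraph k n X) ?G"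
    unfolding de_bruijn_subgraph_def
    using remove_isolated_arcs(3)[OF wf fin] sub by (rule subgraph_trans)
qed

section \<open>Lempel's homomorphism and pseudoweight on lists\<close>

definition letter_weight :: "nat \<Rightarrow> int \<Rightarrow> rat" where
  "letter_weight k c = (if c = 0 then of_nat k / 2 else of_int c)"

lemma pseudoweight_altdef: "pseudoweight k u = sum_list (map (letter_weight k) u)"
  by (simp add: pseudoweight_def letter_weight_def sum_list_sum_nth atLeast0LessThan)

lemma letter_weight_ge_1:
  assumes "k \<ge> 2" "0 \<le> c"
  shows "letter_weight k c \<ge> 1"
  using assms by (simp add: letter_weight_def)

lemma length_lempel [simp]: "length (lempel k a) = length a - 1"
  by (simp add: lempel_def)

lemma lempel_in_tuples:
  assumes "k > 0" "length a = n + 1"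
  shows "lempel k a \<in> tuples k n"
  using assms by (auto simp: tuples_def lempel_def)

lemma lempel_snoc:
  assumes "x \<noteq> []"
  shows "lempel k (x @ [c]) = lempel k x @ [(c - last x) mod int k]"
proof -
  obtain m where m: "length x = Suc m"
    using assms by (cases x) auto
  show ?thesis
    using assms m
    by (intro nth_equalityI) (auto simp: lempel_def nth_append last_conv_nth less_Suc_eq)
qed

lemma lempel_Cons:
  assumes "x \<noteq> []"
  shows "lempel k (c # x) = ((hd x - c) mod int k) # lempel k x"
  using assms
  by (intro nth_equalityI) (auto simp: lempel_def nth_Cons hd_conv_nth split: nat.splits)

section \<open>Light vertices\<close>

text \<open>The summand 1 reserves room for the cheapest possible further difference.\<close>

definition light :: "nat \<Rightarrow> nat \<Rightarrow> int list \<Rightarrow> bool" where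
  "light k n x \<longleftrightarrow> x \<in> tuples k n \<and> pseudoweight k (lempel k x) + 1 < of_nat (n * k) / 2"

definition light_edges :: "nat \<Rightarrow> nat \<Rightarrow> int list set" where
  "light_edges k n = {a \<in> tuples k (n + 1). pseudoweight k (lempel k a) < of_nat (n * k) / 2}"

lemma lempel_preimage_light:
  assumes "k > 0"
  shows "lempel_preimage k n {u \<in> tuples k n. pseudoweight k u < of_nat (n * k) / 2}
    = light_edges k n"
  using lempel_in_tuples[OF assms, of _ n]
  by (auto simp: lempel_preimage_def light_edges_def tuples_def)

text \<open>
  Passing from an edge to one of its endpoints drops one difference, which has weight at least 1.
\<close>

lemma light_edge_endpoints:
  assumes "n \<ge> 1" "k \<ge> 2" "a \<in> light_edges k n"
  shows "light k n (butlast a)" and "light k n (tl a)"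
proof -
  have a: "a \<in> tuples k (n + 1)" "pseudoweight k (lempel k a) < of_nat (n * k) / 2"
    using assms by (auto simp: light_edges_def)
  have ends: "butlast a \<in> tuples k n" "tl a \<in> tuples k n"
    using butlast_tl_arc[OF a(1)] by (auto simp: de_bruijn_def)
  then have "length (butlast a) \<ge> 1" "length (tl a) \<ge> 1"
    using assms(1) by (auto simp: tuples_def)
  then have ne: "butlast a \<noteq> []" "tl a \<noteq> []" "a \<noteq> []"
    by (metis list.size(3) not_one_le_zero list.sel(2))+
  have "lempel k a = lempel k (butlast a) @ [(last a - last (butlast a)) mod int k]"
    using lempel_snoc[OF ne(1), of k "last a"] ne(3) by simp
  moreover have "letter_weight k ((last a - last (butlast a)) mod int k) \<ge> 1"
    using assms by (intro letter_weight_ge_1) auto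
  ultimately show "light k n (butlast a)"
    using a(2) ends by (auto simp: light_def pseudoweight_altdef)
  have "lempel k a = ((hd (tl a) - hd a) mod int k) # lempel k (tl a)"
    using lempel_Cons[OF ne(2), of k "hd a"] ne(3) by simp
  moreover have "letter_weight k ((hd (tl a) - hd a) mod int k) \<ge> 1"
    using assms by (intro letter_weight_ge_1) auto
  ultimately show "light k n (tl a)"
    using a(2) ends by (auto simp: light_def pseudoweight_altdef)
qed

text \<open>
  The next two lemmas are the converse: the new difference is 1, whose weight is exactly the
  room that lightness reserves.
\<close>

lemma light_snoc_edge:
  assumes "n \<ge> 1" "k \<ge> 2" "light k n x"
  shows "x @ [(last x + 1) mod int k] \<in> light_edges k n"
proof -
  have "x \<noteq> []"
    using assms by (auto simp: light_def tuples_def)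
  moreover have "((last x + 1) mod int k - last x) mod int k = 1"
    using assms(2) by (simp add: mod_diff_left_eq)
  ultimately show ?thesis
    using assms
    by (auto simp: light_edges_def lempel_snoc light_def pseudoweight_altdef letter_weight_def
        tuples_def)
qed

lemma light_Cons_edge:
  assumes "n \<ge> 1" "k \<ge> 2" "light k n y"
  shows "((hd y - 1) mod int k) # y \<in> light_edges k n"
proof -
  have "y \<noteq> []"
    using assms by (auto simp: light_def tuples_def)
  moreover have "(hd y - (hd y - 1) mod int k) mod int k = 1"
    using assms(2) by (simp add: mod_diff_right_eq)
  ultimately show ?thesis
    using assms
    by (auto simp: light_edges_def lempel_Cons light_def pseudoweight_altdef letter_weight_def
        tuples_def)
qed

section \<open>Walks along differences 1\<close>

definition ramp :: "nat \<Rightarrow> nat \<Rightarrow> int \<Rightarrow> int list" where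
  "ramp k n c = map (\<lambda>i. (c + int i) mod int k) [0..<n]"

lemma length_ramp [simp]: "length (ramp k n c) = n"
  by (simp add: ramp_def)

lemma ramp_0 [simp]: "ramp k 0 c = []"
  by (simp add: ramp_def)

lemma ramp_snoc: "ramp k (Suc n) c = ramp k n c @ [(c + int n) mod int k]"
  by (simp add: ramp_def)

lemma ramp_Cons: "ramp k (Suc n) c = c mod int k # ramp k n (c + 1)"
  by (intro nth_equalityI) (auto simp: ramp_def nth_Cons add_ac simp del: upt_Suc split: nat.splits)

lemma ramp_cong:
  assumes "c mod int k = d mod int k"
  shows "ramp k n c = ramp k n d"
  unfolding ramp_def using assms by (metis mod_add_left_eq)

lemma lempel_ramp:
  assumes "k \<ge> 2"
  shows "lempel k (ramp k n c) = replicate (n - 1) 1"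
  using assms
  by (intro nth_equalityI) (auto simp: lempel_def ramp_def mod_diff_eq)

lemma light_ramp:
  assumes "n \<ge> 1" "k \<ge> 3"
  shows "light k n (ramp k n c)"
proof -
  have "n * 2 < n * k"
    using assms by simp
  then have "(of_nat (n * 2) :: rat) < of_nat (n * k)"
    unfolding of_nat_less_iff .
  then have "pseudoweight k (lempel k (ramp k n c)) + 1 < of_nat (n * k) / 2"
    using assms
    by (simp add: lempel_ramp pseudoweight_altdef letter_weight_def sum_list_replicate of_nat_diff)
  then show ?thesis
    using assms by (auto simp: light_def tuples_def ramp_def)
qed

text \<open>Follow the edge whose new difference is 1, forwards or backwards.\<close>

definition climb :: "nat \<Rightarrow> int list \<Rightarrow> int list" where
  "climb k x = tl x @ [(last x + 1) mod int k]"

definition descend :: "nat \<Rightarrow> int list \<Rightarrow> int list" where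
  "descend k y = ((hd y - 1) mod int k) # butlast y"

text \<open>
  Each step replaces one more letter by a letter of a ramp that continues the last letter of
  \<open>x\<close>; with \<open>m = length x\<close> only the ramp remains.
\<close>

lemma climb_iterate:
  assumes "x \<noteq> []" "m \<le> length x"
  shows "(climb k ^^ m) x = drop m x @ ramp k m (last x + 1)"
  using assms(2)
proof (induction m)
  case 0
  then show ?case by (simp add: ramp_def)
next
  case (Suc m)
  have "last (drop m x @ ramp k m (last x + 1)) mod int k = (last x + int m) mod int k"
    using Suc.prems by (cases m) (simp_all add: ramp_snoc add_ac)
  then have "(last (drop m x @ ramp k m (last x + 1)) + 1) mod int k
      = (last x + int m + 1) mod int k"
    by (metis mod_add_left_eq)
  moreover have "tl (drop m x @ ramp k m (last x + 1)) = drop (Suc m) x @ ramp k m (last x + 1)"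
    using Suc.prems by (simp add: drop_Suc tl_drop)
  ultimately show ?case
    using Suc by (simp add: climb_def ramp_snoc add_ac)
qed

text \<open>The ramps form a cycle through all residues \<open>c\<close>.\<close>

lemma climb_ramp:
  assumes "n \<ge> 1"
  shows "climb k (ramp k n c) = ramp k n (c + 1)"
proof -
  obtain m where m: "n = Suc m"
    using assms by (cases n) auto
  have "last (ramp k n c) = (c + int m) mod int k"
    by (simp add: m ramp_snoc)
  moreover have "tl (ramp k n c) = ramp k m (c + 1)"
    by (simp add: m ramp_Cons)
  ultimately show ?thesis
    by (simp add: climb_def m ramp_snoc mod_add_right_eq add_ac)
qed

text \<open>
  The mirror image of climbing: the letters in front are those of a ramp that leads up to the
  first letter of \<open>y\<close>.
\<close>

lemma descend_iterate:
  assumes "y \<noteq> []" "m \<le> length y"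
  shows "(descend k ^^ m) y = ramp k m (hd y - int m) @ take (length y - m) y"
  using assms(2)
proof (induction m)
  case 0
  then show ?case by (simp add: ramp_def)
next
  case (Suc m)
  let ?z = "ramp k m (hd y - int m) @ take (length y - m) y"
  have "hd ?z mod int k = (hd y - int m) mod int k"
    using Suc.prems by (cases m) (simp_all add: ramp_Cons)
  then have "(hd ?z - 1) mod int k = (hd y - int m - 1) mod int k"
    by (metis mod_diff_left_eq)
  moreover have "butlast ?z = ramp k m (hd y - int m) @ take (length y - Suc m) y"
    using Suc.prems assms by (simp add: butlast_append butlast_take)
  ultimately show ?case
    using Suc by (simp add: descend_def ramp_Cons diff_diff_eq add_ac)
qed

section \<open>Connectedness\<close>

theorem theorem5p11:
  fixes n k :: nat
    and E :: "int list set"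
    and H :: "(int list, int list \<times> int list) pre_digraph"
  assumes "n \<ge> 2" and "k \<ge> 3"
    and "E = {u \<in> tuples k n. pseudoweight k u < of_nat (n * k) / 2}"
    and "H = de_bruijn_subgraph k n (lempel_preimage k n E)"
  shows "subgraph H (de_bruijn k n)
    \<and> edge_tuple ` arcs H = lempel_preimage k n E
    \<and> connected H
    \<and> strongly_connected H"
proof -
  let ?X = "light_edges k n"
  have n: "n \<ge> 1" and k: "k \<ge> 2"
    using assms by auto
  have X: "?X \<subseteq> tuples k (n + 1)"
    by (auto simp: light_edges_def)
  have EX: "lempel_preimage k n E = ?X"
    using lempel_preimage_light[of k n] k assms(3) by simp
  note H = de_bruijn_subgraph_simps[OF n X, folded EX, folded assms(4), unfolded EX]
  have sub: "subgraph H (de_bruijn k n)"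
    by (rule H(5))
  then interpret H: wf_digraph H
    by (simp add: subgraph_def)
  have "edge_tuple (butlast a, tl a) = a" if "a \<in> ?X" for a
    using that X n by (intro edge_tuple_butlast_tl) (auto simp: tuples_def)
  then have edges: "edge_tuple ` arcs H = lempel_preimage k n E"
    unfolding H(2) image_image EX by simp

  have vert_light: "light k n v" if "v \<in> verts H" for v
    using that light_edge_endpoints[OF n k] unfolding H(1) by auto
  have arc: "butlast a \<rightarrow>\<^bsub>H\<^esub> tl a" if "a \<in> ?X" for a
    using that unfolding arcs_ends_def H(2,3,4) arc_to_ends_def by auto
  have climb: "x \<rightarrow>\<^bsub>H\<^esub> climb k x" if "light k n x" for x
  proof -
    have "x \<noteq> []" using that n by (auto simp: light_def tuples_def)
    then show ?thesis
      using arc[OF light_snoc_edge[OF n k that]] by (simp add: climb_def)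
  qed
  have descend: "descend k y \<rightarrow>\<^bsub>H\<^esub> y" if "light k n y" for y
  proof -
    have "y \<noteq> []" using that n by (auto simp: light_def tuples_def)
    then show ?thesis
      using arc[OF light_Cons_edge[OF n k that]] by (simp add: descend_def)
  qed
  have climbs: "x \<rightarrow>\<^sup>*\<^bsub>H\<^esub> (climb k ^^ m) x" if "x \<in> verts H" for x m
  proof (induction m)
    case (Suc m)
    then have "(climb k ^^ m) x \<rightarrow>\<^bsub>H\<^esub> climb k ((climb k ^^ m) x)"
      by (intro climb vert_light) (rule H.reachable_in_verts(2))
    with Suc show ?case by (simp add: H.reachable_adj_trans)
  qed (use that in simp)
  have descends: "(descend k ^^ m) y \<rightarrow>\<^sup>*\<^bsub>H\<^esub> y" if "y \<in> verts H" for y m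
  proof (induction m)
    case (Suc m)
    then have "descend k ((descend k ^^ m) y) \<rightarrow>\<^bsub>H\<^esub> (descend k ^^ m) y"
      by (intro descend vert_light) (rule H.reachable_in_verts(1))
    with Suc show ?case by (simp add: H.adj_reachable_trans)
  qed (use that in simp)
  have strong: "strongly_connected H"
  proof (rule strongly_connectedI)
    show "verts H \<noteq> {}"
      using climb[OF light_ramp[OF n assms(2)]] H.adj_in_verts(1) by blast
  next
    fix x y
    assume x: "x \<in> verts H" and y: "y \<in> verts H"
    show "x \<rightarrow>\<^sup>*\<^bsub>H\<^esub> y"
    proof -
      have len: "length x = n" "x \<noteq> []" "length y = n" "y \<noteq> []"
        using vert_light[OF x] vert_light[OF y] n by (auto simp: light_def tuples_def)
      define c where "c = last x + 1"
      define d where "d = hd y - int n"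
      have xc: "x \<rightarrow>\<^sup>*\<^bsub>H\<^esub> ramp k n c"
        using climbs[OF x, of n] climb_iterate[of x n k] len by (simp add: c_def)
      have dy: "ramp k n d \<rightarrow>\<^sup>*\<^bsub>H\<^esub> y"
        using descends[OF y, of n] descend_iterate[of y n k] len by (simp add: d_def)
      \<comment> \<open>the number of steps along the cycle of ramps from \<open>c\<close> to \<open>d\<close>\<close>
      define m where "m = nat ((d - c) mod int k)"
      have "(climb k ^^ m) (ramp k n c) = ramp k n (c + int m)"
        using climb_ramp[OF n] by (induction m) (simp_all add: add_ac)
      also have "\<dots> = ramp k n d"
        using k by (intro ramp_cong) (simp add: m_def mod_add_right_eq)
      finally have "ramp k n c \<rightarrow>\<^sup>*\<^bsub>H\<^esub> ramp k n d"
        using climbs[OF H.reachable_in_verts(2)[OF xc], of m] by simp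
      with xc dy show ?thesis
        by (meson H.reachable_trans)
    qed
  qed
  then have "connected H"
    by (auto simp: connected_def strongly_connected_def intro: H.reachable_mk_symmetricI)
  with sub edges strong show ?thesis
    by blast
qed

end
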